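(* Let $M=(W,\{\sim_x\}_{x\in V},\{\mathcal{T}_w\}_{w\in W},\pi)$ be any trustworthiness model, $w\in W$ any world, $U\subseteq V$ any dataset, $F\subseteq\Phi$ any set of formulae and $\phi\in\Phi$ any formula. If $w,U\Vdash f$ for each formula $f\in F$ and $F\vdash\phi$, then $w,U\Vdash\phi$.
   Context: Fix a set $V$ of data variables and a set of atomic propositions. A dataset is a subset of $V$. The language $\Phi$ is generated by $\phi::=p\mid\neg\phi\mid\phi\to\phi\mid{\sf B}^T_X\phi\mid[X]\phi$, where $p$ is an atomic proposition and $X,T\subseteq V$; $\leftrightarrow$ and $\bot$ are defined as usual. A trustworthiness model is a tuple $(W,\{\sim_x\}_{x\in V},\{\mathcal{T}_w\}_{w\in W},\pi)$ where $W$ is a (possibly empty) set of worlds, each $\sim_x$ is an equivalence relation on $W$, $\mathcal{T}_w\subseteq V$ for each $w\in W$, and $\pi(p)\subseteq W\times\mathcal{P}(V)$ for each atomic proposition $p$. Write $w\sim_X u$ if $w\sim_x u$ for every $x\in X$. Satisfaction $w,U\Vdash\phi$ (for $w\in W$, $U\subseteq V$) is defined by: $w,U\Vdash p$ iff $(w,U)\in\pi(p)$; $w,U\Vdash\neg\phi$ iff $w,U\nVdash\phi$; $w,U\Vdash\phi\to\psi$ iff $w,U\nVdash\phi$ or $w,U\Vdash\psi$; $w,U\Vdash{\sf B}^T_X\phi$ iff $w',U\Vdash\phi$ for every $w'\in W$ with $w\sim_{X\cup U}w'$ and $T\subseteq\mathcal{T}_{w'}$; $w,U\Vdash[X]\phi$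 iff $w,U\cup X\Vdash\phi$. The axioms are all propositional tautologies in $\Phi$ and all instances (for arbitrary datasets $X,Y,T,T'\!,X'$ and formulae $\phi,\psi$) of: Truth ${\sf B}^\varnothing_X\phi\to\phi$; Distributivity ${\sf B}^T_X(\phi\to\psi)\to({\sf B}^T_X\phi\to{\sf B}^T_X\psi)$ and $[X](\phi\to\psi)\to([X]\phi\to[X]\psi)$; Negative Introspection $\neg{\sf B}^T_X\phi\to{\sf B}^\varnothing_X\neg{\sf B}^T_X\phi$; Monotonicity ${\sf B}^T_X\phi\to{\sf B}^{T'}_{X'}\phi$ for $T\subseteq T'$, $X\subseteq X'$; Trust ${\sf B}^T_X({\sf B}^T_Y\phi\to\phi)$; Combination $[X][Y]\phi\leftrightarrow[X\cup Y]\phi$; Commutativity $[Y]{\sf B}^T_X\phi\leftrightarrow{\sf B}^T_{Y\cup X}[Y]\phi$; Duality $\neg[X]\phi\leftrightarrow[X]\neg\phi$; Empty Announcement $[\varnothing]\phi\leftrightarrow\phi$. The inference rules are Modus Ponens, and Necessitation: from $\phi$ infer ${\sf B}^T_X\phi$, and from $\phi$ infer $[X]\phi$. $\vdash\phi$ means $\phi$ is derivable from the axioms by these rules (a theorem). $F\vdash\phi$ means $\phi$ is derivable from the theorems together with the formulae in $F$ using Modus Ponens only. *)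

theory Defs
  imports Main
begin

text \<open>
  The set \<open>V\<close> of data variables is an explicit carrier, so that it may be any set, including
  the empty one. The datatype is the syntax over all of the type of \<open>V\<close>; \<open>language V\<close> is \<open>\<Phi>\<close>.
  The atomic propositions are all elements of a type: without any of them \<open>\<Phi>\<close> would be empty.
\<close>

datatype ('p, 'v) form =
    Atom 'p
  | Neg "('p, 'v) form"
  | Imp "('p, 'v) form" "('p, 'v) form"  (infixr \<open>\<^bold>\<rightarrow>\<close> 55)
  | Bel "'v set" "'v set" "('p, 'v) form"  \<comment> \<open>\<open>Bel T X \<phi>\<close>: superscript (trust) first, then subscript\<close>
  | Ann "'v set" "('p, 'v) form"  \<comment> \<open>\<open>[X]\<phi>\<close>\<close>

definition Iff :: "('p, 'v) form \<Rightarrow> ('p, 'v) form \<Rightarrow> ('p, 'v) form"  (infix \<open>\<^bold>\<leftrightarrow>\<close> 54) where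
  "\<phi> \<^bold>\<leftrightarrow> \<psi> = Neg ((\<phi> \<^bold>\<rightarrow> \<psi>) \<^bold>\<rightarrow> Neg (\<psi> \<^bold>\<rightarrow> \<phi>))"

inductive_set language :: "'v set \<Rightarrow> ('p, 'v) form set" for V :: "'v set" where
  "Atom p \<in> language V"
| "\<phi> \<in> language V \<Longrightarrow> Neg \<phi> \<in> language V"
| "\<phi> \<in> language V \<Longrightarrow> \<psi> \<in> language V \<Longrightarrow> (\<phi> \<^bold>\<rightarrow> \<psi>) \<in> language V"
| "T \<subseteq> V \<Longrightarrow> X \<subseteq> V \<Longrightarrow> \<phi> \<in> language V \<Longrightarrow> Bel T X \<phi> \<in> language V"
| "X \<subseteq> V \<Longrightarrow> \<phi> \<in> language V \<Longrightarrow> Ann X \<phi> \<in> language V"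

record ('w, 'v, 'p) model =
  worlds :: "'w set"
  indist :: "'v \<Rightarrow> ('w \<times> 'w) set"
  trusted :: "'w \<Rightarrow> 'v set"
  val :: "'p \<Rightarrow> ('w \<times> 'v set) set"

definition trustworthiness_model :: "'v set \<Rightarrow> ('w, 'v, 'p) model \<Rightarrow> bool" where
  "trustworthiness_model V M \<longleftrightarrow>
     (\<forall>x\<in>V. equiv (worlds M) (indist M x)) \<and>
     (\<forall>w\<in>worlds M. trusted M w \<subseteq> V) \<and>
     (\<forall>p. val M p \<subseteq> worlds M \<times> Pow V)"

definition indist_set :: "('w, 'v, 'p) model \<Rightarrow> 'v set \<Rightarrow> 'w \<Rightarrow> 'w \<Rightarrow> bool" where
  "indist_set M X w u \<longleftrightarrow> (\<forall>x\<in>X. (w, u) \<in> indist M x)"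

primrec sat :: "('w, 'v, 'p) model \<Rightarrow> 'w \<Rightarrow> 'v set \<Rightarrow> ('p, 'v) form \<Rightarrow> bool" where
  "sat M w U (Atom p) \<longleftrightarrow> (w, U) \<in> val M p"
| "sat M w U (Neg \<phi>) \<longleftrightarrow> \<not> sat M w U \<phi>"
| "sat M w U (\<phi> \<^bold>\<rightarrow> \<psi>) \<longleftrightarrow> \<not> sat M w U \<phi> \<or> sat M w U \<psi>"
| "sat M w U (Bel T X \<phi>) \<longleftrightarrow>
     (\<forall>w'\<in>worlds M. indist_set M (X \<union> U) w w' \<and> T \<subseteq> trusted M w' \<longrightarrow> sat M w' U \<phi>)"
| "sat M w U (Ann X \<phi>) \<longleftrightarrow> sat M w (U \<union> X) \<phi>"

text \<open>
  A tautology is true under every truth assignment that treats formulae whose outermost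
  operator is not Boolean as propositional letters.
\<close>

primrec prop_eval :: "(('p, 'v) form \<Rightarrow> bool) \<Rightarrow> ('p, 'v) form \<Rightarrow> bool" where
  "prop_eval e (Atom p) \<longleftrightarrow> e (Atom p)"
| "prop_eval e (Neg \<phi>) \<longleftrightarrow> \<not> prop_eval e \<phi>"
| "prop_eval e (\<phi> \<^bold>\<rightarrow> \<psi>) \<longleftrightarrow> (prop_eval e \<phi> \<longrightarrow> prop_eval e \<psi>)"
| "prop_eval e (Bel T X \<phi>) \<longleftrightarrow> e (Bel T X \<phi>)"
| "prop_eval e (Ann X \<phi>) \<longleftrightarrow> e (Ann X \<phi>)"

definition tautology :: "('p, 'v) form \<Rightarrow> bool" where
  "tautology \<phi> \<longleftrightarrow> (\<forall>e. prop_eval e \<phi>)"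

text \<open>
  The schemes are instantiated without regard to \<open>V\<close>; only the instances in \<open>language V\<close> are used
  below. Since every dataset and formula variable of a scheme occurs in it, these are exactly
  the instances with datasets contained in \<open>V\<close> and formulae in \<open>language V\<close>.
\<close>

inductive axiom_instance :: "('p, 'v) form \<Rightarrow> bool" where
  Tautology: "tautology \<phi> \<Longrightarrow> axiom_instance \<phi>"
| Truth: "axiom_instance (Bel {} X \<phi> \<^bold>\<rightarrow> \<phi>)"
| Distributivity_Bel: "axiom_instance (Bel T X (\<phi> \<^bold>\<rightarrow> \<psi>) \<^bold>\<rightarrow> (Bel T X \<phi> \<^bold>\<rightarrow> Bel T X \<psi>))"
| Distributivity_Ann: "axiom_instance (Ann X (\<phi> \<^bold>\<rightarrow> \<psi>) \<^bold>\<rightarrow> (Ann X \<phi> \<^bold>\<rightarrow> Ann X \<psi>))"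
| Negative_Introspection: "axiom_instance (Neg (Bel T X \<phi>) \<^bold>\<rightarrow> Bel {} X (Neg (Bel T X \<phi>)))"
| Monotonicity: "T \<subseteq> T' \<Longrightarrow> X \<subseteq> X' \<Longrightarrow> axiom_instance (Bel T X \<phi> \<^bold>\<rightarrow> Bel T' X' \<phi>)"
| Trust: "axiom_instance (Bel T X (Bel T Y \<phi> \<^bold>\<rightarrow> \<phi>))"
| Combination: "axiom_instance (Ann X (Ann Y \<phi>) \<^bold>\<leftrightarrow> Ann (X \<union> Y) \<phi>)"
| Commutativity: "axiom_instance (Ann Y (Bel T X \<phi>) \<^bold>\<leftrightarrow> Bel T (Y \<union> X) (Ann Y \<phi>))"
| Duality: "axiom_instance (Neg (Ann X \<phi>) \<^bold>\<leftrightarrow> Ann X (Neg \<phi>))"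
| Empty_Announcement: "axiom_instance (Ann {} \<phi> \<^bold>\<leftrightarrow> \<phi>)"

inductive provable :: "'v set \<Rightarrow> ('p, 'v) form \<Rightarrow> bool" for V :: "'v set" where
  Axiom: "\<phi> \<in> language V \<Longrightarrow> axiom_instance \<phi> \<Longrightarrow> provable V \<phi>"
| Modus_Ponens: "provable V (\<phi> \<^bold>\<rightarrow> \<psi>) \<Longrightarrow> provable V \<phi> \<Longrightarrow> provable V \<psi>"
| Necessitation_Bel: "provable V \<phi> \<Longrightarrow> T \<subseteq> V \<Longrightarrow> X \<subseteq> V \<Longrightarrow> provable V (Bel T X \<phi>)"
| Necessitation_Ann: "provable V \<phi> \<Longrightarrow> X \<subseteq> V \<Longrightarrow> provable V (Ann X \<phi>)"

inductive derivable :: "'v set \<Rightarrow> ('p, 'v) form set \<Rightarrow> ('p, 'v) form \<Rightarrow> bool"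
  for V :: "'v set" and F :: "('p, 'v) form set" where
  Theorem: "provable V \<phi> \<Longrightarrow> derivable V F \<phi>"
| Assumption: "\<phi> \<in> F \<Longrightarrow> derivable V F \<phi>"
| Modus_Ponens: "derivable V F (\<phi> \<^bold>\<rightarrow> \<psi>) \<Longrightarrow> derivable V F \<phi> \<Longrightarrow> derivable V F \<psi>"

end

theory Submission
  imports Defs
begin

text \<open>Soundness goes by induction on derivations in two stages. Every theorem holds at all
  worlds and all datasets inside \<open>V\<close> (\<open>provable_sound\<close>), because the
  axioms do (\<open>axiom_instance_sound\<close>) and the rules preserve this global validity.
  Formulae of \<open>F\<close> are true only at the given pair, but Modus Ponens preserves truth at
  a single pair. Truth and Trust rest on reflexivity of indistinguishability, Negative Introspection
  on its being Euclidean, Monotonicity on larger datasets giving finer relations.\<close>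

inductive_cases language_ImpE [elim!]: "(\<phi> \<^bold>\<rightarrow> \<psi>) \<in> language V"
inductive_cases language_BelE [elim!]: "Bel T X \<phi> \<in> language V"

lemma sat_Iff [simp]: "sat M w U (\<phi> \<^bold>\<leftrightarrow> \<psi>) \<longleftrightarrow> (sat M w U \<phi> \<longleftrightarrow> sat M w U \<psi>)"
  by (auto simp: Iff_def)

text \<open>Truth at a fixed pair is itself a truth assignment respecting the Boolean connectives,
  so tautologies are true there.\<close>

lemma sat_eq_prop_eval: "sat M w U \<phi> \<longleftrightarrow> prop_eval (sat M w U) \<phi>"
  by (induction \<phi>) auto

lemma indist_set_antimono: "indist_set M Y w u \<Longrightarrow> X \<subseteq> Y \<Longrightarrow> indist_set M X w u"
  by (auto simp: indist_set_def)

context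
  fixes V :: "'v set" and M :: "('w, 'v, 'p) model"
  assumes model: "trustworthiness_model V M"
begin

lemma equiv_indist: "x \<in> V \<Longrightarrow> equiv (worlds M) (indist M x)"
  using model by (simp add: trustworthiness_model_def)

lemma indist_set_refl: "X \<subseteq> V \<Longrightarrow> w \<in> worlds M \<Longrightarrow> indist_set M X w w"
  unfolding indist_set_def by (meson equivE equiv_indist refl_onD subsetD)

lemma indist_set_sym: "X \<subseteq> V \<Longrightarrow> indist_set M X w u \<Longrightarrow> indist_set M X u w"
  unfolding indist_set_def by (meson equivE equiv_indist subsetD symD)

lemma indist_set_trans:
  "X \<subseteq> V \<Longrightarrow> indist_set M X w u \<Longrightarrow> indist_set M X u v \<Longrightarrow> indist_set M X w v"
  unfolding indist_set_def by (meson equivE equiv_indist subsetD transD)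

text \<open>Membership in \<open>language V\<close> bounds the datasets of the instance by
  \<open>V\<close>, where indistinguishability is known to be an equivalence.\<close>

lemma axiom_instance_sound:
  assumes "axiom_instance \<phi>" "\<phi> \<in> language V" "w \<in> worlds M" "U \<subseteq> V"
  shows "sat M w U \<phi>"
  using assms
proof (induction \<phi> arbitrary: w U rule: axiom_instance.induct)
  case (Tautology \<phi>)
  then show ?case
    by (metis sat_eq_prop_eval tautology_def)
next
  case (Truth X \<phi>)
  then have "indist_set M (X \<union> U) w w"
    by (intro indist_set_refl) auto
  with Truth.prems show ?case
    by auto
next
  case (Negative_Introspection T X \<phi>)
  then have XU: "X \<union> U \<subseteq> V"
    by auto
  \<comment> \<open>A world \<open>v\<close> refuting the belief at \<open>w\<close> thus also
    refutes it at every \<open>u\<close> indistinguishable from \<open>w\<close>.\<close>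
  have "indist_set M (X \<union> U) u v"
    if "indist_set M (X \<union> U) w u" "indist_set M (X \<union> U) w v" for u v
    using that XU by (blast intro: indist_set_sym indist_set_trans)
  then show ?case
    by auto
next
  case (Monotonicity T T' X X' \<phi>)
  have "indist_set M (X \<union> U) w u" if "indist_set M (X' \<union> U) w u" for u
    using that by (rule indist_set_antimono) (use Monotonicity.hyps in auto)
  with Monotonicity.hyps show ?case
    by auto
next
  case (Trust T X Y \<phi>)
  \<comment> \<open>If \<open>T\<close> is trusted at \<open>u\<close>, then \<open>u\<close> is
    among the worlds over which the inner belief at \<open>u\<close> quantifies.\<close>
  then have "indist_set M (Y \<union> U) u u" if "u \<in> worlds M" for u
    using that by (intro indist_set_refl) auto
  then show ?case
    by auto
next
  case (Commutativity Y T X \<phi>)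
  \<comment> \<open>Both sides evaluate \<open>\<phi>\<close> under \<open>U \<union> Y\<close>;
    their accessibility relations are indexed by these two equal sets.\<close>
  have "Y \<union> X \<union> U = X \<union> (U \<union> Y)"
    by auto
  then show ?case
    by simp
qed (auto simp: Un_assoc)

text \<open>\<open>w\<close> and \<open>U\<close> are generalised because necessitation for belief
  moves to other worlds, and for announcements to \<open>U \<union> X\<close>, still inside
  \<open>V\<close>.\<close>

lemma provable_sound:
  "provable V \<phi> \<Longrightarrow> w \<in> worlds M \<Longrightarrow> U \<subseteq> V \<Longrightarrow> sat M w U \<phi>"
  by (induction \<phi> arbitrary: w U rule: provable.induct) (auto intro: axiom_instance_sound)

end

theorem theorem1:
  fixes V :: "'v set" and M :: "('w, 'v, 'p) model" and w :: 'w and U :: "'v set"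
    and F :: "('p, 'v) form set" and \<phi> :: "('p, 'v) form"
  assumes "trustworthiness_model V M"
    and "w \<in> worlds M"
    and "U \<subseteq> V"
    and "F \<subseteq> language V"
    and "\<phi> \<in> language V"
    and "\<forall>f\<in>F. sat M w U f"
    and "derivable V F \<phi>"
  shows "sat M w U \<phi>"
  using assms(7)
\<comment> \<open>Here \<open>w\<close> and \<open>U\<close> stay fixed: no necessitation applies to
  consequences of \<open>F\<close>.\<close>
proof (induction rule: derivable.induct)
  case (Theorem \<phi>)
  with assms(1-3) show ?case
    by (blast intro: provable_sound)
qed (use assms(6) in auto)

end
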